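(* Let $\mathcal{G}$ be an undirected graph with $n\geq d+1$ vertices. If $(\mathcal{G},p)$ is infinitesimally weakly rigid for some generic configuration $p\in\mathbb{R}^{nd}$, then $\mathcal{G}$ is generically infinitesimally weakly rigid in $\mathbb{R}^d$.
   Context: Graphs $\mathcal{G}=(\mathcal{V},\mathcal{E})$ are finite, simple and undirected, $\mathcal{V}=\{1,\dots,n\}$, and $(i,j)$, $(j,i)$ denote the same edge. A framework $(\mathcal{G},p)$ in $\mathbb{R}^d$ is a graph with a configuration $p=(p_1^T,\dots,p_n^T)^T\in\mathbb{R}^{nd}$; $e_{ij}=p_i-p_j$. Let $\mathcal{T}_\mathcal{G}=\{(i,j,k)\in\mathcal{V}^3:(i,j),(i,k)\in\mathcal{E},\ j\leq k\}$. For $\mathcal{T}_\mathcal{G}^*\subseteq\mathcal{T}_\mathcal{G}$, let $r_\mathcal{G}(p)=(\dots,e_{ij}^Te_{ik},\dots)^T$, $(i,j,k)\in\mathcal{T}_\mathcal{G}^*$, and $R_w(p)=\frac{\partial r_\mathcal{G}}{\partial p}$. $(\mathcal{G},p)$ is infinitesimally weakly rigid if there exists $\mathcal{T}_\mathcal{G}^*\subseteq\mathcal{T}_\mathcal{G}$ with $\mathrm{rank}(R_w(p))=nd-d(d+1)/2$. A configuration $p\in\mathbb{R}^{nd}$ is generic if its $nd$ coordinates are algebraically independent over the integers, i.e. there is no nonzero polynomial $h(x_1,\dots,x_{nd})$ with integer coefficients vanishing at the coordinates of $p$. The graph $\mathcal{G}$ is generically infinitesimally weakly rigid in $\mathbb{R}^d$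 if for every generic configuration $q\in\mathbb{R}^{nd}$ the framework $(\mathcal{G},q)$ is infinitesimally weakly rigid. *)

theory Defs
  imports "HOL-Analysis.Analysis" "HOL-Library.Poly_Mapping"
begin

text \<open>
  The ordered vertex set \<open>{1,\<dots>,n}\<close> is a type \<open>'n::{finite,linorder}\<close> with \<open>n = CARD('n)\<close>, the
  dimension is \<open>d = CARD('d)\<close>, and \<open>\<real>\<^sup>n\<^sup>d\<close> is \<open>real^('n \<times> 'd)\<close>.  A graph is given by its set
  of edges, each edge being present as both \<open>(i, j)\<close> and \<open>(j, i)\<close>.
\<close>

definition simple_graph :: "'n rel \<Rightarrow> bool" where
  "simple_graph E \<longleftrightarrow> irrefl E \<and> sym E"

definition point :: "real^('n::finite \<times> 'd::finite) \<Rightarrow> 'n \<Rightarrow> real^'d" where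
  "point p i = (\<chi> a. p $ (i, a))"

definition edge_vec :: "real^('n::finite \<times> 'd::finite) \<Rightarrow> 'n \<Rightarrow> 'n \<Rightarrow> real^'d" where
  "edge_vec p i j = point p i - point p j"

definition angle_triples :: "'n::linorder rel \<Rightarrow> ('n \<times> 'n \<times> 'n) set" where
  "angle_triples E = {(i, j, k). (i, j) \<in> E \<and> (i, k) \<in> E \<and> j \<le> k}"

text \<open>
  The vector \<open>(\<dots>, e\<^sub>i\<^sub>j\<^sup>T e\<^sub>i\<^sub>k, \<dots>)\<close> with \<open>(i, j, k) \<in> T\<close> is padded with zero entries at all
  triples outside \<open>T\<close>, so that its codomain does not depend on \<open>T\<close>.  The Jacobian is padded with
  zero rows, which leaves its rank unchanged.
\<close>

definition weak_rigidity_fun ::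
  "('n \<times> 'n \<times> 'n) set \<Rightarrow> real^('n::finite \<times> 'd::finite) \<Rightarrow> real^('n \<times> 'n \<times> 'n)" where
  "weak_rigidity_fun T p =
     (\<chi> t. if t \<in> T then (case t of (i, j, k) \<Rightarrow> edge_vec p i j \<bullet> edge_vec p i k) else 0)"

definition weak_rigidity_matrix ::
  "('n \<times> 'n \<times> 'n) set \<Rightarrow> real^('n::finite \<times> 'd::finite) \<Rightarrow> real^('n \<times> 'd)^('n \<times> 'n \<times> 'n)" where
  "weak_rigidity_matrix T p = jacobian (weak_rigidity_fun T) (at p)"

lemma weak_rigidity_fun_differentiable:
  fixes p :: "real^('n::finite \<times> 'd::finite)"
  shows "weak_rigidity_fun T differentiable (at p)"
proof -
  have nth: "(\<lambda>q::real^('n \<times> 'd). q $ v) differentiable (at p)" for v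
    by (intro bounded_linear_imp_differentiable bounded_linear_vec_nth)
  have "(\<lambda>q. weak_rigidity_fun T q $ t) differentiable (at p)" for t
    by (cases t; cases "t \<in> T")
       (auto simp: weak_rigidity_fun_def edge_vec_def point_def inner_vec_def
             intro!: derivative_intros nth differentiable_sum)
  then show ?thesis
    by (subst differentiable_componentwise_within)
       (auto simp: Basis_vec_def inner_axis)
qed

text \<open>The rank condition is stated over \<open>real\<close> to avoid truncated subtraction.\<close>

definition inf_weakly_rigid ::
  "'n rel \<Rightarrow> real^('n::{finite,linorder} \<times> 'd::finite) \<Rightarrow> bool" where
  "inf_weakly_rigid E p \<longleftrightarrow>
     (\<exists>T \<subseteq> angle_triples E.
        real (rank (weak_rigidity_matrix T p)) =
          real CARD('n) * real CARD('d) - real CARD('d) * (real CARD('d) + 1) / 2)"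

text \<open>
  Integer polynomials in variables indexed by \<open>'v\<close> are finitely supported maps from monomials
  \<open>'v \<Rightarrow>\<^sub>0 nat\<close> to coefficients.
\<close>

definition poly_eval :: "(('v::finite \<Rightarrow>\<^sub>0 nat) \<Rightarrow>\<^sub>0 int) \<Rightarrow> real^'v \<Rightarrow> real" where
  "poly_eval h x =
     (\<Sum>m\<in>Poly_Mapping.keys h. of_int (Poly_Mapping.lookup h m) *
        (\<Prod>v\<in>UNIV. (x $ v) ^ Poly_Mapping.lookup m v))"

definition generic_config :: "real^('n::finite \<times> 'd::finite) \<Rightarrow> bool" where
  "generic_config p \<longleftrightarrow>
     \<not> (\<exists>h :: (('n \<times> 'd) \<Rightarrow>\<^sub>0 nat) \<Rightarrow>\<^sub>0 int. h \<noteq> 0 \<and> poly_eval h p = 0)"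

text \<open>The type argument \<open>'d\<close> fixes the ambient space \<open>\<real>\<^sup>d\<close>.\<close>

definition generically_inf_weakly_rigid ::
  "'d::finite itself \<Rightarrow> 'n::{finite,linorder} rel \<Rightarrow> bool" where
  "generically_inf_weakly_rigid _ E \<longleftrightarrow>
     (\<forall>q :: real^('n \<times> 'd). generic_config q \<longrightarrow> inf_weakly_rigid E q)"

end

theory Submission
  imports Defs
begin

text \<open>
  Two generic configurations \<open>p\<close> and \<open>q\<close> annihilate the same integer polynomials (only the zero
  polynomial), so \<open>h(p) \<mapsto> h(q)\<close> is a ring isomorphism \<open>\<int>[p] \<cong> \<int>[q]\<close>.  It carries the rigidity
  matrix at \<open>p\<close> to the one at \<open>q\<close>, and fraction-free Gaussian elimination shows that such an
  isomorphism preserves rank.  Hence the same set of triples works for \<open>p\<close> and \<open>q\<close>.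
\<close>

text \<open>One step of fraction-free elimination with pivot \<open>v i $ c\<close>. The new vectors
  have coordinate \<open>c\<close> equal to 0, so they lie in a hyperplane that misses
  \<open>v i\<close>, and \<open>v i\<close> adds exactly one dimension.\<close>

lemma dim_image_eliminate:
  fixes v :: "'i \<Rightarrow> real^'c"
  assumes "v i $ c \<noteq> 0"
  shows "dim (v ` insert i I) = dim ((\<lambda>j. (v i $ c) *\<^sub>R v j - (v j $ c) *\<^sub>R v i) ` I) + 1"
proof -
  define v' where "v' j = (v i $ c) *\<^sub>R v j - (v j $ c) *\<^sub>R v i" for j
  have "v' j \<in> span (v ` insert i I)" if "j \<in> I" for j
    unfolding v'_def using that by (intro span_diff span_scale span_base) auto
  \<comment> \<open>Division by the pivot only serves to compare real spans; the vectors
    \<open>v'\<close> themselves are formed without it.\<close>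
  moreover have "v j \<in> span (insert (v i) (v' ` I))" if "j \<in> I" for j
  proof -
    have "v j = (1 / (v i $ c)) *\<^sub>R (v' j + (v j $ c) *\<^sub>R v i)"
      using assms by (simp add: v'_def)
    moreover have "(1 / (v i $ c)) *\<^sub>R (v' j + (v j $ c) *\<^sub>R v i) \<in> span (insert (v i) (v' ` I))"
      using that by (intro span_scale span_add span_base) auto
    ultimately show ?thesis by simp
  qed
  ultimately have "span (v ` insert i I) = span (insert (v i) (v' ` I))"
    unfolding span_eq by (auto intro: span_base)
  then have "dim (v ` insert i I) = dim (insert (v i) (v' ` I))"
    by (metis dim_span)
  moreover have "v i \<notin> span (v' ` I)"
  proof
    assume "v i \<in> span (v' ` I)"
    moreover have "subspace {x :: real^'c. x $ c = 0}"
      by (simp add: subspace_def)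
    moreover have "v' ` I \<subseteq> {x. x $ c = 0}"
      by (auto simp: v'_def)
    ultimately have "v i $ c = 0"
      using span_minimal by blast
    with assms show False by simp
  qed
  ultimately show ?thesis
    by (simp add: dim_insert v'_def)
qed

text \<open>Elimination runs in parallel on both families: \<open>zero\<close> makes a pivot of one
  family a pivot of the other, and each step lowers both dimensions by one.\<close>

lemma dim_image_eq_if_related:
  fixes v w :: "'i \<Rightarrow> real^'c" and R :: "real \<Rightarrow> real \<Rightarrow> bool"
  assumes diff: "\<And>a b a' b'. R a b \<Longrightarrow> R a' b' \<Longrightarrow> R (a - a') (b - b')"
    and mult: "\<And>a b a' b'. R a b \<Longrightarrow> R a' b' \<Longrightarrow> R (a * a') (b * b')"
    and zero: "\<And>a b. R a b \<Longrightarrow> a = 0 \<longleftrightarrow> b = 0"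
    and "finite I" and "\<And>i c. i \<in> I \<Longrightarrow> R (v i $ c) (w i $ c)"
  shows "dim (v ` I) = dim (w ` I)"
  using assms(4,5)
proof (induction I arbitrary: v w rule: finite_induct)
  case empty
  show ?case by simp
next
  case (insert i I)
  show ?case
  proof (cases "v i = 0")
    case True
    then have "w i = 0"
      using insert.prems[of i] zero by (auto simp: vec_eq_iff)
    with True show ?thesis
      using insert.IH[of v w] insert.prems by (simp add: dim_insert span_zero)
  next
    case False
    then obtain c where c: "v i $ c \<noteq> 0"
      by (auto simp: vec_eq_iff)
    with insert.prems[of i c] zero have "w i $ c \<noteq> 0"
      by auto
    \<comment> \<open>The eliminated entries are differences of products, hence still related by
      \<open>diff\<close> and \<open>mult\<close>. The induction hypothesis applies to them because
      it is stated for arbitrary families.\<close>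
    moreover have "dim ((\<lambda>j. (v i $ c) *\<^sub>R v j - (v j $ c) *\<^sub>R v i) ` I)
        = dim ((\<lambda>j. (w i $ c) *\<^sub>R w j - (w j $ c) *\<^sub>R w i) ` I)"
      by (rule insert.IH) (simp add: diff mult insert.prems)
    ultimately show ?thesis
      using dim_image_eliminate[of v i c I] dim_image_eliminate[of w i c I] c by simp
  qed
qed

text \<open>The graph of the correspondence from h(p) to h(q), kept as a relation so that its
  closure properties can be proved before it is known to be single-valued.\<close>

definition eval_related :: "real^'v::finite \<Rightarrow> real^'v \<Rightarrow> real \<Rightarrow> real \<Rightarrow> bool" where
  "eval_related p q a b \<longleftrightarrow> (\<exists>h. a = poly_eval h p \<and> b = poly_eval h q)"

text \<open>Coefficients outside \<open>keys\<close> vanish, so several polynomials can be evaluated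
  over one common set of monomials.\<close>

lemma poly_eval_superset:
  assumes "finite A" "Poly_Mapping.keys h \<subseteq> A"
  shows "poly_eval h x = (\<Sum>m\<in>A. of_int (Poly_Mapping.lookup h m) *
           (\<Prod>v\<in>UNIV. (x $ v) ^ Poly_Mapping.lookup m v))"
  unfolding poly_eval_def using assms
  by (intro sum.mono_neutral_left) (auto simp: in_keys_iff)

lemma poly_eval_add: "poly_eval (h + k) x = poly_eval h x + poly_eval k x"
proof -
  have "Poly_Mapping.keys (h + k) \<subseteq> Poly_Mapping.keys h \<union> Poly_Mapping.keys k"
    by (rule Poly_Mapping.keys_add)
  then show ?thesis
    by (simp add: poly_eval_superset[of "Poly_Mapping.keys h \<union> Poly_Mapping.keys k"]
        lookup_add distrib_right sum.distrib)
qed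

lemma poly_eval_single:
  "poly_eval (Poly_Mapping.single m c) x =
     of_int c * (\<Prod>v\<in>UNIV. (x $ v) ^ Poly_Mapping.lookup m v)"
  by (subst poly_eval_superset[of "{m}"]) auto

lemma eval_related_add:
  "eval_related p q a b \<Longrightarrow> eval_related p q a' b' \<Longrightarrow> eval_related p q (a + a') (b + b')"
  unfolding eval_related_def by (metis poly_eval_add)

lemma eval_related_single:
  "eval_related p q (of_int c * (\<Prod>v\<in>UNIV. (p $ v) ^ Poly_Mapping.lookup m v))
                    (of_int c * (\<Prod>v\<in>UNIV. (q $ v) ^ Poly_Mapping.lookup m v))"
  unfolding eval_related_def by (metis poly_eval_single)

lemma eval_related_of_int: "eval_related p q (of_int c) (of_int c)"
  using eval_related_single[of p q c 0] by simp

lemma eval_related_sum: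
  assumes "\<And>i. i \<in> I \<Longrightarrow> eval_related p q (f i) (g i)"
  shows "eval_related p q (sum f I) (sum g I)"
  using assms
proof (induction I rule: infinite_finite_induct)
  case (insert i I)
  then show ?case by (simp add: eval_related_add)
\<comment> \<open>Over an empty or an infinite index set both sums are 0.\<close>
qed (use eval_related_of_int[of p q 0] in auto)

text \<open>The product of two evaluations expands into a double sum of integer multiples of
  monomials; closure under sums then suffices, and the product polynomial is never formed.\<close>

lemma eval_related_mult:
  assumes "eval_related p q a b" "eval_related p q a' b'"
  shows "eval_related p q (a * a') (b * b')"
proof -
  obtain h k where "a = poly_eval h p" "b = poly_eval h q"
      "a' = poly_eval k p" "b' = poly_eval k q"
    using assms unfolding eval_related_def by blast
  moreover have "poly_eval h x * poly_eval k x =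
      (\<Sum>m\<in>Poly_Mapping.keys h. \<Sum>n\<in>Poly_Mapping.keys k.
         of_int (Poly_Mapping.lookup h m * Poly_Mapping.lookup k n) *
         (\<Prod>v\<in>UNIV. (x $ v) ^ Poly_Mapping.lookup (m + n) v))" for x
    unfolding poly_eval_def
    by (simp add: sum_product lookup_add power_add prod.distrib mult_ac)
  ultimately show ?thesis
    by (simp only:) (intro eval_related_sum eval_related_single)
qed

lemma eval_related_diff:
  assumes "eval_related p q a b" "eval_related p q a' b'"
  shows "eval_related p q (a - a') (b - b')"
  using eval_related_add[OF assms(1) eval_related_mult[OF eval_related_of_int[of p q "-1"] assms(2)]]
  by simp

lemma eval_related_nth: "eval_related p q (p $ u) (q $ u)"
proof -
  have "(\<Prod>v\<in>UNIV. (x $ v) ^ Poly_Mapping.lookup (Poly_Mapping.single u 1) v) = x $ u"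
    for x :: "real^'a"
  proof -
    have "(x $ v) ^ Poly_Mapping.lookup (Poly_Mapping.single u 1) v = (if v = u then x $ v else 1)" for v
      by (simp add: lookup_single when_def)
    then show ?thesis by simp
  qed
  then show ?thesis
    using eval_related_single[of p q 1 "Poly_Mapping.single u 1"] by simp
qed

text \<open>Here genericity enters: a common polynomial \<open>h\<close> is either 0, and both
  values vanish, or nonzero, and neither does.\<close>

lemma eval_related_zero_iff:
  assumes "generic_config p" "generic_config q" "eval_related p q a b"
  shows "a = 0 \<longleftrightarrow> b = 0"
proof -
  obtain h where h: "a = poly_eval h p" "b = poly_eval h q"
    using assms(3) unfolding eval_related_def by blast
  show ?thesis
  proof (cases "h = 0")
    case True
    then show ?thesis by (simp add: h poly_eval_def)
  next
    case False
    with assms(1,2) have "a \<noteq> 0" "b \<noteq> 0"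
      unfolding h generic_config_def by blast+
    then show ?thesis by simp
  qed
qed

text \<open>The product rule for the inner product, evaluated in direction \<open>axis u 1\<close>.
  In this form each entry is visibly an integer polynomial in the coordinates of
  \<open>p\<close>.\<close>

lemma weak_rigidity_matrix_nth:
  fixes p :: "real^('n::finite \<times> 'd::finite)"
  shows "weak_rigidity_matrix T p $ (i, j, k) $ u =
    (if (i, j, k) \<in> T then edge_vec p i j \<bullet> edge_vec (axis u 1) i k
       + edge_vec (axis u 1) i j \<bullet> edge_vec p i k else 0)"
proof -
  let ?D = "frechet_derivative (weak_rigidity_fun T) (at p)"
  have "(weak_rigidity_fun T has_derivative ?D) (at p)"
    using weak_rigidity_fun_differentiable frechet_derivative_works by blast
  then have D: "((\<lambda>q. weak_rigidity_fun T q $ (i, j, k)) has_derivative (\<lambda>x. ?D x $ (i, j, k))) (at p)"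
    by (rule bounded_linear.has_derivative[OF bounded_linear_vec_nth])
  have linear: "linear (\<lambda>q :: real^('n \<times> 'd). edge_vec q a b)" for a b
    by (rule linearI) (auto simp: edge_vec_def point_def vec_eq_iff algebra_simps)
  have edge: "((\<lambda>q. edge_vec q a b) has_derivative (\<lambda>x. edge_vec x a b)) (at p)" for a b
    by (intro bounded_linear_imp_has_derivative linear_conv_bounded_linear[THEN iffD1] linear)
  have "((\<lambda>q. weak_rigidity_fun T q $ (i, j, k)) has_derivative
     (\<lambda>x. if (i, j, k) \<in> T then edge_vec p i j \<bullet> edge_vec x i k
       + edge_vec x i j \<bullet> edge_vec p i k else 0)) (at p)"
    by (cases "(i, j, k) \<in> T") (auto simp: weak_rigidity_fun_def intro!: has_derivative_inner edge)
  \<comment> \<open>Column \<open>u\<close> of the Jacobian is \<open>?D (axis u 1)\<close>, so the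
    two derivatives are compared at that vector.\<close>
  from has_derivative_unique[OF D this] show ?thesis
    by (simp add: weak_rigidity_matrix_def jacobian_def matrix_def fun_eq_iff)
qed

lemma eval_related_weak_rigidity_matrix:
  fixes p q :: "real^('n::finite \<times> 'd::finite)"
  shows "eval_related p q (weak_rigidity_matrix T p $ t $ u) (weak_rigidity_matrix T q $ t $ u)"
proof -
  obtain i j k where t: "t = (i, j, k)"
    by (cases t)
  have zero: "eval_related p q 0 0"
    using eval_related_of_int[of p q 0] by simp
  \<comment> \<open>Entries of a unit vector are the integers 0 and 1, the same at \<open>p\<close>
    and \<open>q\<close>.\<close>
  have axis: "eval_related p q (axis u 1 $ v) (axis u 1 $ v)" for v
    using zero eval_related_of_int[of p q 1] by (simp add: axis_def)
  show ?thesis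
    unfolding t weak_rigidity_matrix_nth
    by (auto simp: zero inner_vec_def edge_vec_def point_def
        intro!: eval_related_add eval_related_sum eval_related_mult eval_related_diff
          eval_related_nth axis)
qed

lemma rank_weak_rigidity_matrix_generic:
  fixes p q :: "real^('n::finite \<times> 'd::finite)"
  assumes "generic_config p" "generic_config q"
  shows "rank (weak_rigidity_matrix T p) = rank (weak_rigidity_matrix T q)"
proof -
  \<comment> \<open>Row rank, with the rows as a family indexed by triples, is the form that the
    elimination lemma handles.\<close>
  have rank: "rank A = dim (($) A ` UNIV)" for A :: "real^('n \<times> 'd)^('n \<times> 'n \<times> 'n)"
    by (simp add: row_rank_def rows_def row_def vec_nth_inverse full_SetCompr_eq del: split_paired_Ex)
  show ?thesis
    unfolding rank
    by (rule dim_image_eq_if_related[of "eval_related p q"])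
       (fact finite eval_related_diff eval_related_mult eval_related_zero_iff[OF assms]
        | rule eval_related_weak_rigidity_matrix)+
qed

theorem theorem3p16:
  fixes E :: "'n::{finite,linorder} rel"
  assumes "simple_graph E"
    and "CARD('n) \<ge> CARD('d::finite) + 1"
    and "\<exists>p :: real^('n \<times> 'd). generic_config p \<and> inf_weakly_rigid E p"
  shows "generically_inf_weakly_rigid TYPE('d) E"
proof -
  obtain p :: "real^('n \<times> 'd)" where p: "generic_config p" "inf_weakly_rigid E p"
    using assms(3) by blast
  have "inf_weakly_rigid E q" if "generic_config q" for q :: "real^('n \<times> 'd)"
    \<comment> \<open>The ranks agree for every \<open>T\<close> and the target rank does not depend
      on the configuration, so the rewriting takes place under the existential quantifier.\<close>
    using p(2) unfolding inf_weakly_rigid_def rank_weak_rigidity_matrix_generic[OF p(1) that] .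
  then show ?thesis
    unfolding generically_inf_weakly_rigid_def by blast
qed

end
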